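(* Let $a>0$. There are no compact composition operators on the Paley-Wiener space $B^2_a$; that is, for every $c\in\mathbb{R}$ with $0<|c|\leq 1$ and every $d\in\mathbb{C}$, the composition operator $C_\phi f=f\circ\phi$ on $B^2_a$ with symbol $\phi(z)=cz+d$ is not compact.
   Context: For $a>0$, the Paley-Wiener space $B^2_a$ is the Hilbert space of all entire functions of exponential type less than or equal to $a$ whose restriction to $\mathbb{R}$ belongs to $L^2(\mathbb{R})$, with inner product $\langle f,g\rangle=\int_{-\infty}^{\infty}f(t)\overline{g(t)}\,dt$ and norm $\|\cdot\|_a$. Convention: a composition operator on $B^2_a$ means an operator $C_\phi f=f\circ\phi$ with symbol $\phi(z)=cz+d$, $z\in\mathbb{C}$, where $c\in\mathbb{R}$, $0<|c|\leq1$, $d\in\mathbb{C}$; it is known that these are exactly the symbols inducing bounded composition operators on $B^2_a$. *)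

theory Defs
  imports "HOL-Complex_Analysis.Complex_Analysis"
begin

text \<open>Exponential type at most a, i.e. limsup of log M(r) / r is at most a for r to infinity, where
  M(r) is the maximum of |f| on |z| = r; written out with bounds, which also covers f = 0.\<close>

definition exponential_type_le :: "real \<Rightarrow> (complex \<Rightarrow> complex) \<Rightarrow> bool" where
  "exponential_type_le a f \<longleftrightarrow>
     (\<forall>\<epsilon>>0. \<exists>K. \<forall>z. norm (f z) \<le> K * exp ((a + \<epsilon>) * norm z))"

definition paley_wiener :: "real \<Rightarrow> (complex \<Rightarrow> complex) set" where
  "paley_wiener a =
     {f. f holomorphic_on UNIV \<and> exponential_type_le a f \<and>
         integrable lborel (\<lambda>t::real. (norm (f (of_real t)))\<^sup>2)}"

definition pw_inner :: "(complex \<Rightarrow> complex) \<Rightarrow> (complex \<Rightarrow> complex) \<Rightarrow> complex" where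
  "pw_inner f g = (LINT t|lborel. f (complex_of_real t) * cnj (g (complex_of_real t)))"

definition pw_norm :: "(complex \<Rightarrow> complex) \<Rightarrow> real" where
  "pw_norm f = sqrt (Re (pw_inner f f))"

definition pw_dist :: "(complex \<Rightarrow> complex) \<Rightarrow> (complex \<Rightarrow> complex) \<Rightarrow> real" where
  "pw_dist f g = pw_norm (\<lambda>z. f z - g z)"

text \<open>Compactness of an operator T on the normed space with carrier M and metric d: T maps bounded
  sets to relatively compact sets. The other requirements on a compact operator, linearity and
  T mapping M into M, are not part of the predicate, so that its negation for a particular linear T
  is a failure of compactness proper.\<close>

definition compact_operator_on :: "'a set \<Rightarrow> ('a \<Rightarrow> 'a \<Rightarrow> real) \<Rightarrow> ('a \<Rightarrow> 'a) \<Rightarrow> bool" where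
  "compact_operator_on M d T \<longleftrightarrow>
     (\<forall>B. Metric_space.mbounded M d B \<longrightarrow>
        compactin (Metric_space.mtopology M d) (Metric_space.mtopology M d closure_of (T ` B)))"

definition composition_operator :: "(complex \<Rightarrow> complex) \<Rightarrow> (complex \<Rightarrow> complex) \<Rightarrow> (complex \<Rightarrow> complex)" where
  "composition_operator \<phi> f = f \<circ> \<phi>"

lemma pw_norm_eq: "pw_norm f = sqrt (LINT t|lborel. (norm (f (complex_of_real t)))\<^sup>2)"
proof -
  have "pw_inner f f = (LINT t|lborel. complex_of_real ((norm (f (complex_of_real t)))\<^sup>2))"
    unfolding pw_inner_def by (intro Bochner_Integration.integral_cong refl) (rule complex_norm_square[symmetric])
  also have "\<dots> = complex_of_real (LINT t|lborel. (norm (f (complex_of_real t)))\<^sup>2)"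
    by (rule integral_complex_of_real)
  finally show ?thesis
    by (simp only: pw_norm_def Re_complex_of_real)
qed

lemma paley_wiener_measurable:
  assumes "f \<in> paley_wiener a"
  shows "(\<lambda>t. f (complex_of_real t)) \<in> borel_measurable lborel"
    and "continuous_on UNIV (\<lambda>t. f (complex_of_real t))"
proof -
  have "continuous_on UNIV f"
    using assms by (auto simp: paley_wiener_def intro: holomorphic_on_imp_continuous_on)
  then show c: "continuous_on UNIV (\<lambda>t. f (complex_of_real t))"
    by (rule continuous_on_compose2) (auto intro: continuous_intros)
  show "(\<lambda>t. f (complex_of_real t)) \<in> borel_measurable lborel"
    using borel_measurable_continuous_onI[OF c] by simp
qed

lemma norm_add_sq_le:
  fixes u v :: complex and s :: real
  assumes "s > 0"
  shows "(norm (u + v))\<^sup>2 \<le> (1 + s) * (norm u)\<^sup>2 + (1 + 1 / s) * (norm v)\<^sup>2"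
proof -
  have "(norm (u + v))\<^sup>2 \<le> (norm u + norm v)\<^sup>2"
    by (intro power_mono norm_triangle_ineq) auto
  also have "\<dots> = (1 + s) * (norm u)\<^sup>2 + (1 + 1 / s) * (norm v)\<^sup>2 - (s * norm u - norm v)\<^sup>2 / s"
    using assms by (simp add: field_simps power2_eq_square)
  also have "\<dots> \<le> (1 + s) * (norm u)\<^sup>2 + (1 + 1 / s) * (norm v)\<^sup>2"
    using assms by simp
  finally show ?thesis .
qed

lemma paley_wiener_add:
  assumes f: "f \<in> paley_wiener a" and g: "g \<in> paley_wiener a"
  shows "(\<lambda>z. f z + g z) \<in> paley_wiener a"
proof -
  have "exponential_type_le a (\<lambda>z. f z + g z)"
    unfolding exponential_type_le_def
  proof (intro allI impI)
    fix e :: real assume e: "e > 0"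
    obtain K where K: "\<And>z. norm (f z) \<le> K * exp ((a + e) * norm z)"
      using f e unfolding paley_wiener_def exponential_type_le_def by blast
    obtain L where L: "\<And>z. norm (g z) \<le> L * exp ((a + e) * norm z)"
      using g e unfolding paley_wiener_def exponential_type_le_def by blast
    have "norm (f z + g z) \<le> (K + L) * exp ((a + e) * norm z)" for z
      using K[of z] L[of z] norm_triangle_ineq[of "f z" "g z"] by (simp add: distrib_right)
    then show "\<exists>K. \<forall>z. norm (f z + g z) \<le> K * exp ((a + e) * norm z)" by blast
  qed
  moreover have "integrable lborel (\<lambda>t. (norm (f (complex_of_real t) + g (complex_of_real t)))\<^sup>2)"
  proof (rule Bochner_Integration.integrable_bound)
    show "integrable lborel
      (\<lambda>t. 2 * (norm (f (complex_of_real t)))\<^sup>2 + 2 * (norm (g (complex_of_real t)))\<^sup>2)"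
      using f g by (auto simp: paley_wiener_def)
    show "(\<lambda>t. (norm (f (complex_of_real t) + g (complex_of_real t)))\<^sup>2) \<in> borel_measurable lborel"
      using paley_wiener_measurable(1)[OF f] paley_wiener_measurable(1)[OF g] by measurable
    show "AE t in lborel. norm ((norm (f (complex_of_real t) + g (complex_of_real t)))\<^sup>2)
        \<le> norm (2 * (norm (f (complex_of_real t)))\<^sup>2 + 2 * (norm (g (complex_of_real t)))\<^sup>2)"
      using norm_add_sq_le[of 1] by (auto intro!: AE_I2)
  qed
  ultimately show ?thesis
    using f g by (auto simp: paley_wiener_def intro: holomorphic_intros)
qed

lemma paley_wiener_cmult:
  assumes f: "f \<in> paley_wiener a"
  shows "(\<lambda>z. c * f z) \<in> paley_wiener a"
proof -
  have "exponential_type_le a (\<lambda>z. c * f z)"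
    unfolding exponential_type_le_def
  proof (intro allI impI)
    fix e :: real assume e: "e > 0"
    obtain K where K: "\<And>z. norm (f z) \<le> K * exp ((a + e) * norm z)"
      using f e unfolding paley_wiener_def exponential_type_le_def by blast
    have "norm (c * f z) \<le> (norm c * K) * exp ((a + e) * norm z)" for z
      using mult_left_mono[OF K[of z], of "norm c"] by (simp add: norm_mult mult.assoc)
    then show "\<exists>K. \<forall>z. norm (c * f z) \<le> K * exp ((a + e) * norm z)" by blast
  qed
  then show ?thesis
    using f by (auto simp: paley_wiener_def norm_mult power_mult_distrib intro: holomorphic_intros)
qed

lemma paley_wiener_diff:
  assumes "f \<in> paley_wiener a" "g \<in> paley_wiener a"
  shows "(\<lambda>z. f z - g z) \<in> paley_wiener a"
  using paley_wiener_add[OF assms(1) paley_wiener_cmult[OF assms(2), of "-1"]] by simp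

lemma pw_norm_triangle:
  assumes f: "f \<in> paley_wiener a" and g: "g \<in> paley_wiener a"
  shows "pw_norm (\<lambda>z. f z + g z) \<le> pw_norm f + pw_norm g"
proof (rule field_le_epsilon)
  fix e :: real assume e: "e > 0"
  define A where "A = pw_norm f + e / 2"
  define B where "B = pw_norm g + e / 2"
  have nn: "0 \<le> pw_norm f" "0 \<le> pw_norm g"
    by (simp_all add: pw_norm_eq)
  have AB: "A > 0" "B > 0" using nn e by (auto simp: A_def B_def)
  have sq: "(LINT t|lborel. (norm (h (complex_of_real t)))\<^sup>2) = (pw_norm h)\<^sup>2" for h
    by (simp add: pw_norm_eq)
  have int: "integrable lborel (\<lambda>t. (norm (h (complex_of_real t)))\<^sup>2)"
    if "h \<in> paley_wiener a" for h using that by (simp add: paley_wiener_def)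
  have "(pw_norm (\<lambda>z. f z + g z))\<^sup>2
      \<le> (LINT t|lborel. (1 + B / A) * (norm (f (complex_of_real t)))\<^sup>2
                       + (1 + 1 / (B / A)) * (norm (g (complex_of_real t)))\<^sup>2)"
    unfolding sq[symmetric]
    using int[OF f] int[OF g] int[OF paley_wiener_add[OF f g]] AB
    by (intro integral_mono norm_add_sq_le) auto
  also have "\<dots> = (1 + B / A) * (pw_norm f)\<^sup>2 + (1 + A / B) * (pw_norm g)\<^sup>2"
    using int[OF f] int[OF g] by (simp add: sq)
  also have "\<dots> \<le> (1 + B / A) * A\<^sup>2 + (1 + A / B) * B\<^sup>2"
    using AB nn e by (intro add_mono mult_left_mono power_mono) (auto simp: A_def B_def)
  also have "\<dots> = (A + B)\<^sup>2"
    using AB by (simp add: field_simps power2_eq_square)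
  finally have "pw_norm (\<lambda>z. f z + g z) \<le> A + B"
    by (rule power2_le_imp_le) (use AB in simp)
  then show "pw_norm (\<lambda>z. f z + g z) \<le> pw_norm f + pw_norm g + e"
    by (simp add: A_def B_def)
qed

lemma pw_norm_eq_0_iff:
  assumes h: "h \<in> paley_wiener a"
  shows "pw_norm h = 0 \<longleftrightarrow> h = (\<lambda>_. 0)"
proof
  assume "pw_norm h = 0"
  then have "(LINT t|lborel. (norm (h (complex_of_real t)))\<^sup>2) = 0"
    by (simp add: pw_norm_eq)
  then have "AE t in lborel. (norm (h (complex_of_real t)))\<^sup>2 = 0"
    using h by (subst (asm) integral_nonneg_eq_0_iff_AE) (auto simp: paley_wiener_def)
  then have ae: "AE t in lebesgue. t \<in> {t. h (complex_of_real t) = 0}"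
    by (intro AE_completion) auto
  have "closed {t. h (complex_of_real t) = 0}"
    using continuous_closed_preimage_constant[of UNIV "\<lambda>t. h (complex_of_real t)" 0]
      paley_wiener_measurable(2)[OF h] by auto
  from mem_closed_if_AE_lebesgue[OF this ae]
  have z: "h (complex_of_real t) = 0" for t by auto
  have "h w = 0" for w
  proof (rule analytic_continuation[of h UNIV "\<real>" 0])
    show "h holomorphic_on UNIV" using h by (simp add: paley_wiener_def)
    show "(0::complex) islimpt \<real>"
      unfolding islimpt_approachable
    proof (intro allI impI)
      fix e :: real assume "e > 0"
      then show "\<exists>x'\<in>\<real>. x' \<noteq> 0 \<and> dist x' (0::complex) < e"
        by (intro bexI[of _ "complex_of_real (e / 2)"]) (auto simp: norm_divide)
    qed
  qed (use z in \<open>auto elim!: Reals_cases\<close>)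
  then show "h = (\<lambda>_. 0)" by auto
qed (simp add: pw_norm_eq)

lemma Metric_space_paley_wiener: "Metric_space (paley_wiener a) pw_dist"
proof
  show "0 \<le> pw_dist f g" for f g by (simp add: pw_dist_def pw_norm_eq)
  show "pw_dist f g = pw_dist g f" for f g
    by (simp add: pw_dist_def pw_norm_eq norm_minus_commute)
  show "pw_dist f g = 0 \<longleftrightarrow> f = g" if "f \<in> paley_wiener a" "g \<in> paley_wiener a" for f g
    using pw_norm_eq_0_iff[OF paley_wiener_diff[OF that]] by (auto simp: pw_dist_def fun_eq_iff)
  show "pw_dist f h \<le> pw_dist f g + pw_dist g h"
    if "f \<in> paley_wiener a" "g \<in> paley_wiener a" "h \<in> paley_wiener a" for f g h
    using pw_norm_triangle[OF paley_wiener_diff[OF that(1,2)] paley_wiener_diff[OF that(2,3)]]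
    by (simp add: pw_dist_def)
qed

end

theory Submission
  imports Defs "HOL-Probability.Sinc_Integral"
begin

text \<open>The functions \<open>f (z - k)\<close>, where \<open>f (z) = sin (a z) / z\<close> and \<open>k\<close> is real, all have the same
  norm. A composition operator with affine symbol of real slope maps them to translates of the single
  nonzero function \<open>g = f \<circ> \<phi>\<close>, and \<open>g\<close> tends to zero at infinity along the real line. Hence
  translates of \<open>g\<close> that are far apart have distance bounded below, and the image of a suitable
  bounded sequence has no Cauchy subsequence.\<close>

section \<open>Compactness and separated sequences\<close>

text \<open>A compact closure of the image would yield a convergent, hence Cauchy, subsequence, and
  two of its late terms would be closer than \<delta>. Separation for \<open>m < n\<close> suffices
  since \<open>r\<close> is strictly increasing.\<close>

lemma not_compact_operator_on_if_separated:
  fixes \<sigma> :: "nat \<Rightarrow> 'a"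
  assumes M: "Metric_space M d" and bdd: "Metric_space.mbounded M d (range \<sigma>)"
    and T: "\<And>n. T (\<sigma> n) \<in> M"
    and "\<delta> > 0" and sep: "\<And>m n. m < n \<Longrightarrow> \<delta> \<le> d (T (\<sigma> m)) (T (\<sigma> n))"
  shows "\<not> compact_operator_on M d T"
proof
  interpret Metric_space M d by (fact M)
  assume "compact_operator_on M d T"
  then have "compactin mtopology (mtopology closure_of (T ` range \<sigma>))"
    using bdd by (simp add: compact_operator_on_def)
  moreover have "range (T \<circ> \<sigma>) \<subseteq> mtopology closure_of (T ` range \<sigma>)"
    using T closure_of_subset[of "T ` range \<sigma>" mtopology] by auto
  ultimately obtain l r where r: "strict_mono r"
    and lim: "limitin mtopology (T \<circ> \<sigma> \<circ> r) l sequentially"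
    unfolding compactin_sequentially by blast
  have "MCauchy (T \<circ> \<sigma> \<circ> r)"
    using T by (intro convergent_imp_MCauchy[OF _ lim]) auto
  then obtain N where "\<And>n n'. N \<le> n \<Longrightarrow> N \<le> n' \<Longrightarrow> d (T (\<sigma> (r n))) (T (\<sigma> (r n'))) < \<delta>"
    using \<open>\<delta> > 0\<close> unfolding MCauchy_def comp_def by meson
  from this[of N "Suc N"] sep[of "r N" "r (Suc N)"] r show False
    by (simp add: strict_mono_def)
qed

section \<open>Translation along the real line\<close>

text \<open>The norm sees only the real line, where Lebesgue measure is invariant under the real
  shift \<open>s\<close>.\<close>

lemma pw_norm_translate: "pw_norm (\<lambda>z. f (z - complex_of_real s)) = pw_norm f"
  using lborel_integral_real_affine[of 1 "\<lambda>t. (norm (f (complex_of_real t)))\<^sup>2" "- s"]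
  by (simp add: pw_norm_eq)

lemma pw_dist_translate:
  "pw_dist (\<lambda>z. f (z - complex_of_real s)) (\<lambda>z. f (z - complex_of_real t))
    = pw_dist f (\<lambda>z. f (z - complex_of_real (t - s)))"
  using pw_norm_translate[of "\<lambda>z. f z - f (z - complex_of_real (t - s))" s]
  by (simp add: pw_dist_def)

text \<open>On a short interval around a real point where \<open>g\<close> is nonzero,
  \<open>g\<close> stays away from 0, while a far translate is small there by decay. This interval
  alone keeps the distance bounded below.\<close>

lemma pw_dist_translate_ge:
  assumes g: "g \<in> paley_wiener a" and nz: "g \<noteq> (\<lambda>_. 0)"
    and lim: "((\<lambda>t. g (complex_of_real t)) \<longlongrightarrow> 0) at_infinity"
    and g': "\<And>s. (\<lambda>z. g (z - complex_of_real s)) \<in> paley_wiener a"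
  obtains \<delta> S where "\<delta> > 0" "S > 0"
    "\<And>s. \<bar>s\<bar> \<ge> S \<Longrightarrow> \<delta> \<le> pw_dist g (\<lambda>z. g (z - complex_of_real s))"
proof -
  \<comment> \<open>A priori \<open>g\<close> may be known to be nonzero only off the real axis; the
    identity theorem behind \<open>pw_norm_eq_0_iff\<close> gives a nonzero value at a real
    point.\<close>
  have "pw_norm g \<noteq> 0"
    using pw_norm_eq_0_iff[OF g] nz by simp
  then obtain t0 where t0: "g (complex_of_real t0) \<noteq> 0"
    unfolding pw_norm_eq by fastforce
  \<comment> \<open>With a quarter of the value at \<open>t0\<close>, \<open>g\<close> has modulus
    at least \<open>3 * p\<close> on the interval and its translate less than \<open>p\<close>, so
    the difference exceeds \<open>p\<close>.\<close>
  define p where "p = norm (g (complex_of_real t0)) / 4"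
  have p: "p > 0" using t0 by (simp add: p_def)
  have "isCont (\<lambda>t. g (complex_of_real t)) t0"
    using paley_wiener_measurable(2)[OF g] by (simp add: continuous_on_eq_continuous_at)
  then obtain e where e: "e > 0"
    and near: "\<And>t. dist t t0 < e \<Longrightarrow> dist (g (complex_of_real t)) (g (complex_of_real t0)) < p"
    using p unfolding continuous_at_eps_delta by blast
  obtain X where X: "\<And>t. \<bar>t\<bar> \<ge> X \<Longrightarrow> norm (g (complex_of_real t)) < p"
    using tendstoD[OF lim p] by (auto simp: eventually_at_infinity)
  define I where "I = {t0 - e / 2..t0 + e / 2}"
  \<comment> \<open>For \<open>t\<close> in \<open>I\<close> and
    \<open>\<bar>s\<bar> \<ge> S\<close> this forces
    \<open>\<bar>t - s\<bar> \<ge> \<bar>X\<bar>\<close>; the absolute value covers a negative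
    \<open>X\<close>.\<close>
  define S where "S = \<bar>X\<bar> + \<bar>t0\<bar> + e"
  show thesis
  proof
    \<comment> \<open>\<open>I\<close> has length \<open>e\<close>, and the squared difference is at
      least \<open>p\<^sup>2\<close> on it.\<close>
    show "sqrt (e * p\<^sup>2) > 0" "S > 0"
      using e p by (auto simp: S_def)
    fix s :: real assume s: "\<bar>s\<bar> \<ge> S"
    let ?h = "\<lambda>t. (norm (g (complex_of_real t) - g (complex_of_real t - complex_of_real s)))\<^sup>2"
    have ge: "p\<^sup>2 \<le> ?h t" if "t \<in> I" for t
    proof -
      have "norm (g (complex_of_real t)) \<ge> 3 * p"
      proof -
        have "dist t t0 < e"
          using that e by (auto simp: I_def dist_real_def abs_if)
        from near[OF this] have "norm (g (complex_of_real t0)) - norm (g (complex_of_real t)) < p"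
          using norm_triangle_ineq3[of "g (complex_of_real t0)" "g (complex_of_real t)"]
          by (simp add: dist_norm norm_minus_commute)
        then show ?thesis by (simp add: p_def)
      qed
      moreover have "norm (g (complex_of_real (t - s))) < p"
        using s that e by (intro X) (auto simp: I_def S_def)
      ultimately have "p \<le> norm (g (complex_of_real t) - g (complex_of_real t - complex_of_real s))"
        using norm_triangle_ineq2[of "g (complex_of_real t)" "g (complex_of_real (t - s))"] p by simp
      then show ?thesis using p by (intro power_mono) auto
    qed
    have "integrable lborel ?h"
      using paley_wiener_diff[OF g g'[of s]] by (simp add: paley_wiener_def)
    moreover have "integrable lborel (\<lambda>t. p\<^sup>2 * indicator I t)"
      using e by (simp add: I_def)
    moreover have "p\<^sup>2 * indicator I t \<le> ?h t" for t
      using ge[of t] by (simp add: indicator_def)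
    ultimately have "(LINT t|lborel. p\<^sup>2 * indicator I t) \<le> (LINT t|lborel. ?h t)"
      by (intro integral_mono)
    moreover have "(LINT t|lborel. p\<^sup>2 * indicator I t) = e * p\<^sup>2"
      using e by (simp add: I_def)
    ultimately have "e * p\<^sup>2 \<le> (LINT t|lborel. ?h t)"
      by (simp only:)
    then show "sqrt (e * p\<^sup>2) \<le> pw_dist g (\<lambda>z. g (z - complex_of_real s))"
      by (simp add: pw_dist_def pw_norm_eq)
  qed
qed

section \<open>The entire function sin (a z) / z and its affine substitutions\<close>

text \<open>The value at 0 removes the singularity. Up to the factor pi this is the reproducing
  kernel of the Paley-Wiener space at 0.\<close>

definition sinc_scaled :: "real \<Rightarrow> complex \<Rightarrow> complex" where
  "sinc_scaled a z = (if z = 0 then complex_of_real a else sin (complex_of_real a * z) / z)"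

text \<open>This is the difference quotient of \<open>sin (a z)\<close> at 0, completed by the
  derivative there, so the removable singularity theorem applies.\<close>

lemma holomorphic_sinc_scaled: "sinc_scaled a holomorphic_on UNIV"
proof -
  have "((\<lambda>z. sin (complex_of_real a * z)) has_field_derivative complex_of_real a) (at 0)"
    by (auto intro!: derivative_eq_intros)
  then have d: "deriv (\<lambda>z. sin (complex_of_real a * z)) 0 = complex_of_real a"
    by (rule DERIV_imp_deriv)
  have "(\<lambda>z. sin (complex_of_real a * z)) holomorphic_on UNIV"
    by (intro holomorphic_intros)
  from pole_lemma_open[OF this open_UNIV, of 0] show ?thesis
    by (rule back_subst[where P = "\<lambda>f. f holomorphic_on UNIV"]) (simp add: d sinc_scaled_def fun_eq_iff)
qed

text \<open>One bound for both purposes: the exponential controls the type, the denominator gives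
  decay and square integrability on horizontal lines. Compactness handles the unit disc; outside it,
  \<open>1 + norm z \<le> 2 * norm z\<close>.\<close>

lemma norm_sinc_scaled_le:
  assumes "a > 0"
  obtains K where "K \<ge> 0" "\<And>z. norm (sinc_scaled a z) \<le> K * exp (a * \<bar>Im z\<bar>) / (1 + norm z)"
proof -
  have "compact (sinc_scaled a ` cball 0 1)"
    by (intro compact_continuous_image holomorphic_on_imp_continuous_on
        holomorphic_on_subset[OF holomorphic_sinc_scaled]) auto
  then obtain M where M: "M > 0" "\<And>z. norm z \<le> 1 \<Longrightarrow> norm (sinc_scaled a z) \<le> M"
    by (force simp: bounded_pos dest: compact_imp_bounded)
  show thesis
  proof
    show "0 \<le> 2 * (M + 1)" using M by simp
    fix z :: complex
    define E where "E = exp (a * \<bar>Im z\<bar>)"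
    have E: "E \<ge> 1" using assms by (simp add: E_def)
    have "(1 + norm z) * norm (sinc_scaled a z) \<le> 2 * (M + 1) * E"
    proof (cases "norm z \<le> 1")
      case True
      then have "(1 + norm z) * norm (sinc_scaled a z) \<le> 2 * M"
        using M by (intro mult_mono) auto
      also have "\<dots> \<le> 2 * (M + 1) * E"
        using E M by (simp add: mult_mono[of "2 * M" "2 * (M + 1)" 1 E, simplified])
      finally show ?thesis .
    next
      case False
      then have z: "norm z > 1" by simp
      have "norm (sin (complex_of_real a * z)) \<le> E"
        using cmod_sin_le_exp[of 1 "complex_of_real a * z"] assms by (simp add: E_def abs_mult)
      then have "(1 + norm z) * norm (sinc_scaled a z) \<le> (2 * norm z) * (E / norm z)"
        using z E by (intro mult_mono) (auto simp: sinc_scaled_def norm_divide divide_right_mono)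
      also have "\<dots> = 2 * E" using z by auto
      also have "\<dots> \<le> 2 * (M + 1) * E" using E M by simp
      finally show ?thesis .
    qed
    moreover have "1 + norm z > 0"
      by (simp add: add_pos_nonneg)
    ultimately show "norm (sinc_scaled a z) \<le> 2 * (M + 1) * exp (a * \<bar>Im z\<bar>) / (1 + norm z)"
      unfolding E_def by (simp add: pos_le_divide_eq mult.commute)
  qed
qed

text \<open>As \<open>c\<close> is real, the argument runs along a horizontal line, so the
  exponential factor is the constant \<open>exp (a * \<bar>Im w\<bar>)\<close>.\<close>

lemma norm_sinc_scaled_affine_le:
  assumes "a > 0"
  obtains K where "K \<ge> 0" "\<And>t. norm (sinc_scaled a (complex_of_real c * complex_of_real t + w))
     \<le> K / (1 + \<bar>Re w + c * t\<bar>)"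
proof -
  obtain K where K: "K \<ge> 0"
    "\<And>z. norm (sinc_scaled a z) \<le> K * exp (a * \<bar>Im z\<bar>) / (1 + norm z)"
    using norm_sinc_scaled_le[OF assms] by blast
  show thesis
  proof
    show "0 \<le> K * exp (a * \<bar>Im w\<bar>)" using K by simp
    fix t :: real
    let ?z = "complex_of_real c * complex_of_real t + w"
    have "\<bar>Re w + c * t\<bar> \<le> norm ?z"
      using abs_Re_le_cmod[of ?z] by (simp add: add.commute)
    then have "K * exp (a * \<bar>Im ?z\<bar>) / (1 + norm ?z) \<le> K * exp (a * \<bar>Im w\<bar>) / (1 + \<bar>Re w + c * t\<bar>)"
      using K by (intro frac_le) auto
    with K(2)[of ?z] show "norm (sinc_scaled a ?z) \<le> K * exp (a * \<bar>Im w\<bar>) / (1 + \<bar>Re w + c * t\<bar>)"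
      by linarith
  qed
qed

lemma sinc_scaled_affine_in_paley_wiener:
  assumes a: "a > 0" and c: "0 < \<bar>c\<bar>" "\<bar>c\<bar> \<le> 1"
  shows "(\<lambda>z. sinc_scaled a (complex_of_real c * z + w)) \<in> paley_wiener a" (is "?g \<in> _")
proof -
  have hol: "?g holomorphic_on UNIV"
    by (rule holomorphic_on_compose_gen[OF _ holomorphic_sinc_scaled, unfolded o_def])
      (auto intro!: holomorphic_intros)
  obtain K where K: "K \<ge> 0"
    "\<And>z. norm (sinc_scaled a z) \<le> K * exp (a * \<bar>Im z\<bar>) / (1 + norm z)"
    using norm_sinc_scaled_le[OF a] by blast
  have "exponential_type_le a ?g"
    unfolding exponential_type_le_def
  proof (intro allI impI exI)
    fix e :: real and z :: complex
    assume e: "e > 0"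
    let ?z = "complex_of_real c * z + w"
    have "norm ?z \<le> \<bar>c\<bar> * norm z + norm w"
      using norm_triangle_ineq[of "complex_of_real c * z" w] by (simp add: norm_mult)
    \<comment> \<open>Here \<open>\<bar>c\<bar> \<le> 1\<close> keeps the type at most
      \<open>a\<close>; the shift \<open>w\<close> only costs a constant factor.\<close>
    also have "\<dots> \<le> norm z + norm w"
      using c mult_right_mono[of "\<bar>c\<bar>" 1 "norm z"] by simp
    finally have "a * norm ?z \<le> a * norm w + a * norm z"
      using a mult_left_mono[of "norm ?z" "norm z + norm w" a] by (simp add: algebra_simps)
    moreover have "a * \<bar>Im ?z\<bar> \<le> a * norm ?z"
      using a by (intro mult_left_mono abs_Im_le_cmod) auto
    moreover have "0 \<le> e * norm z"
      using e by simp
    ultimately have le: "a * \<bar>Im ?z\<bar> \<le> a * norm w + (a + e) * norm z"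
      by (simp only: distrib_right)
    have "norm (?g z) \<le> K * exp (a * \<bar>Im ?z\<bar>) / (1 + norm ?z)"
      by (rule K)
    also have "\<dots> \<le> K * exp (a * \<bar>Im ?z\<bar>) / 1"
      using K by (intro divide_left_mono) (auto simp: add_pos_nonneg)
    also have "\<dots> \<le> K * exp (a * norm w + (a + e) * norm z)"
      using K le by (simp add: mult_left_mono)
    finally show "norm (?g z) \<le> (K * exp (a * norm w)) * exp ((a + e) * norm z)"
      by (simp add: exp_add mult.assoc)
  qed
  moreover have "integrable lborel (\<lambda>t. (norm (?g (complex_of_real t)))\<^sup>2)"
  proof -
    obtain L where L: "L \<ge> 0" "\<And>t. norm (?g (complex_of_real t)) \<le> L / (1 + \<bar>Re w + c * t\<bar>)"
      using norm_sinc_scaled_affine_le[OF a] by blast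
    show ?thesis
    proof (rule Bochner_Integration.integrable_bound)
      \<comment> \<open>The majorant is the derivative of arctan after an affine substitution, which
        is legitimate because \<open>c\<close> is nonzero.\<close>
      have "integrable lborel (\<lambda>t::real. inverse (1 + t\<^sup>2))"
        using integrable_inverse_1_plus_square by (simp add: set_integrable_def)
      from lborel_integrable_real_affine[OF this, of c "Re w"] c
      show "integrable lborel (\<lambda>t. L\<^sup>2 * inverse (1 + (Re w + c * t)\<^sup>2))"
        by simp
      have "continuous_on UNIV ?g"
        using hol by (rule holomorphic_on_imp_continuous_on)
      then have "continuous_on UNIV (\<lambda>t. (norm (?g (complex_of_real t)))\<^sup>2)"
        by (intro continuous_intros) (auto elim!: continuous_on_compose2 intro!: continuous_intros)
      then show "(\<lambda>t. (norm (?g (complex_of_real t)))\<^sup>2) \<in> borel_measurable lborel"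
        using borel_measurable_continuous_onI by simp
      show "AE t in lborel. norm ((norm (?g (complex_of_real t)))\<^sup>2)
          \<le> norm (L\<^sup>2 * inverse (1 + (Re w + c * t)\<^sup>2))"
      proof (rule AE_I2)
        fix t :: real
        let ?x = "Re w + c * t"
        have "(norm (?g (complex_of_real t)))\<^sup>2 \<le> (L / (1 + \<bar>?x\<bar>))\<^sup>2"
          by (intro power_mono L) auto
        also have "\<dots> = L\<^sup>2 / (1 + \<bar>?x\<bar>)\<^sup>2"
          by (simp add: power_divide)
        also have "\<dots> \<le> L\<^sup>2 / (1 + ?x\<^sup>2)"
        proof (rule frac_le)
          have "1 + y\<^sup>2 \<le> (1 + \<bar>y\<bar>)\<^sup>2" for y :: real
            by (simp add: power2_sum)
          then show "1 + ?x\<^sup>2 \<le> (1 + \<bar>?x\<bar>)\<^sup>2" .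
        qed (auto simp: add_pos_nonneg)
        finally show "norm ((norm (?g (complex_of_real t)))\<^sup>2) \<le> norm (L\<^sup>2 * inverse (1 + ?x\<^sup>2))"
          by (simp add: divide_inverse)
      qed
    qed
  qed
  ultimately show ?thesis
    using hol by (simp add: paley_wiener_def)
qed

lemma sinc_scaled_affine_tendsto_0:
  assumes "a > 0" "c \<noteq> 0"
  shows "((\<lambda>t. sinc_scaled a (complex_of_real c * complex_of_real t + w)) \<longlongrightarrow> 0) at_infinity"
proof -
  obtain K where K: "K \<ge> 0" "\<And>t. norm (sinc_scaled a (complex_of_real c * complex_of_real t + w))
     \<le> K / (1 + \<bar>Re w + c * t\<bar>)"
    using norm_sinc_scaled_affine_le[OF assms(1)] by blast
  have "filterlim (\<lambda>t. c * t) at_infinity at_infinity"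
    using assms(2) by (intro tendsto_mult_filterlim_at_infinity[where c = c] filterlim_ident) auto
  then have "filterlim (\<lambda>t. Re w + c * t) at_infinity at_infinity"
    by (rule tendsto_add_filterlim_at_infinity[OF tendsto_const])
  then have "filterlim (\<lambda>t. \<bar>Re w + c * t\<bar>) at_top at_infinity"
    using filterlim_at_infinity_imp_norm_at_top by fastforce
  then have "filterlim (\<lambda>t. 1 + \<bar>Re w + c * t\<bar>) at_top at_infinity"
    by (rule filterlim_tendsto_add_at_top[OF tendsto_const])
  then have "((\<lambda>t. K / (1 + \<bar>Re w + c * t\<bar>)) \<longlongrightarrow> 0) at_infinity"
    by (rule real_tendsto_divide_at_top[OF tendsto_const])
  then show ?thesis
    by (rule Lim_null_comparison[OF always_eventually, rotated]) (intro allI K)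
qed

section \<open>Failure of compactness\<close>

theorem proposition2p2:
  fixes a c :: real and d :: complex
  assumes "a > 0" and "0 < \<bar>c\<bar>" and "\<bar>c\<bar> \<le> 1"
  shows "\<not> compact_operator_on (paley_wiener a) pw_dist
            (composition_operator (\<lambda>z. complex_of_real c * z + d))"
proof -
  interpret Metric_space "paley_wiener a" pw_dist
    by (rule Metric_space_paley_wiener)
  have c: "c \<noteq> 0" using assms by simp
  define f where "f = sinc_scaled a"
  define g where "g = (\<lambda>z. f (complex_of_real c * z + d))"
  have f_translate: "(\<lambda>z. f (z - complex_of_real s)) \<in> paley_wiener a" for s
    using sinc_scaled_affine_in_paley_wiener[OF assms(1), of 1 "- complex_of_real s"]
    by (simp add: f_def)
  have g_translate: "(\<lambda>z. g (z - complex_of_real s)) \<in> paley_wiener a" for s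
    using sinc_scaled_affine_in_paley_wiener[OF assms, of "d - complex_of_real c * complex_of_real s"]
    by (simp add: f_def g_def algebra_simps)
  \<comment> \<open>This point is the zero of the symbol, and \<open>f\<close> takes the value
    \<open>a > 0\<close> at 0.\<close>
  have "g (- d / complex_of_real c) = complex_of_real a"
    using c by (simp add: g_def f_def sinc_scaled_def)
  then have "g \<noteq> (\<lambda>_. 0)"
    using assms(1) by auto
  moreover have "((\<lambda>t. g (complex_of_real t)) \<longlongrightarrow> 0) at_infinity"
    using sinc_scaled_affine_tendsto_0[OF assms(1) c] by (simp add: g_def f_def)
  ultimately obtain \<delta> S where \<delta>: "\<delta> > 0" and S: "S > 0"
    and sep: "\<And>s. \<bar>s\<bar> \<ge> S \<Longrightarrow> \<delta> \<le> pw_dist g (\<lambda>z. g (z - complex_of_real s))"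
    using pw_dist_translate_ge[of g a] g_translate g_translate[of 0] by auto
  \<comment> \<open>The factor \<open>c\<close> in the shift cancels under the symbol:
    \<open>c * z + d - c * S * n = c * (z - S * n) + d\<close>. The images are thus translates of
    \<open>g\<close> with spacing \<open>S\<close>.\<close>
  define \<sigma> :: "nat \<Rightarrow> complex \<Rightarrow> complex"
    where "\<sigma> n = (\<lambda>z. f (z - complex_of_real (c * (S * real n))))" for n
  have T: "composition_operator (\<lambda>z. complex_of_real c * z + d) (\<sigma> n)
      = (\<lambda>z. g (z - complex_of_real (S * real n)))" for n
    by (simp add: composition_operator_def \<sigma>_def g_def fun_eq_iff algebra_simps)
  show ?thesis
  proof (rule not_compact_operator_on_if_separated[OF Metric_space_paley_wiener, where \<sigma> = \<sigma>])
    have zero: "(\<lambda>_. 0) \<in> paley_wiener a"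
      using paley_wiener_cmult[OF f_translate, of 0] by simp
    \<comment> \<open>Translation invariance puts the whole sequence on one sphere around 0.\<close>
    have "pw_dist (\<lambda>_. 0) (\<sigma> n) = pw_norm f" for n
    proof -
      have "pw_dist (\<lambda>_. 0) (\<sigma> n) = pw_norm (\<sigma> n)"
        by (simp add: pw_dist_def pw_norm_eq)
      then show ?thesis
        by (simp only: \<sigma>_def pw_norm_translate)
    qed
    moreover have "\<sigma> n \<in> paley_wiener a" for n
      unfolding \<sigma>_def by (rule f_translate)
    ultimately show "mbounded (range \<sigma>)"
      using zero unfolding mbounded by (auto intro!: exI[of _ "\<lambda>_. 0"])
    show "composition_operator (\<lambda>z. complex_of_real c * z + d) (\<sigma> n) \<in> paley_wiener a" for n
      unfolding T by (rule g_translate)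
    show "\<delta> > 0" by (fact \<delta>)
    show "\<delta> \<le> pw_dist (composition_operator (\<lambda>z. complex_of_real c * z + d) (\<sigma> m))
        (composition_operator (\<lambda>z. complex_of_real c * z + d) (\<sigma> n))" if "m < n" for m n
    proof -
      have "S * 1 \<le> S * (real n - real m)"
        using S that by (intro mult_left_mono) auto
      then have "S \<le> \<bar>S * real n - S * real m\<bar>"
        by (simp add: right_diff_distrib)
      then show ?thesis
        unfolding T pw_dist_translate by (rule sep)
    qed
  qed
qed

end
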